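(* Let $n \in \mathbb{N}$ with $n\ge 1$ and let $\mathbb{K}$ be a non-Archimedean valued field with valuation $|\cdot|$. Let $(a_j)_{j=1}^n, (b_j)_{j=1}^n \in \mathbb{K}^n$. Then $$\left|\sum_{j=1}^{n}a_jb_j\right|^2\leq \max\left\{\left|\sum_{j=1}^n a_j^2\right|\left|\sum_{k=1}^n b_k^2\right|,\ \max_{1\leq j<k \leq n}|a_jb_k-a_kb_j|^2\right\}\leq \left(\max_{1\leq j \leq n}|a_j|\right)^2\left(\max_{1\leq k \leq n}|b_k|\right)^2.$$
   Context: A non-Archimedean valued field is a field $\mathbb{K}$ with a map $|\cdot|:\mathbb{K}\to[0,\infty)$ such that (i) $|\lambda|=0$ if and only if $\lambda=0$; (ii) $|\lambda\mu|=|\lambda||\mu|$ for all $\lambda,\mu\in\mathbb{K}$; (iii) $|\lambda+\mu|\leq\max\{|\lambda|,|\mu|\}$ for all $\lambda,\mu\in\mathbb{K}$. For $n=1$ the maximum over the empty set of pairs $j<k$ is taken to be $0$. *)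

theory Defs
  imports Complex_Main
begin

locale nonarch_valued_field =
  fixes val :: "'a::field \<Rightarrow> real"
  assumes val_nonneg: "0 \<le> val x"
    and val_eq_0_iff: "val x = 0 \<longleftrightarrow> x = 0"
    and val_mult: "val (x * y) = val x * val y"
    and val_add_le_max: "val (x + y) \<le> max (val x) (val y)"

text \<open>The library operator \<open>Max\<close> is unspecified on the empty set; this variant takes the
  maximum over the empty set to be \<open>0\<close>.\<close>

definition Max0 :: "real set \<Rightarrow> real" where
  "Max0 A = (if A = {} then 0 else Max A)"

end

theory Submission
  imports Defs
begin

text \<open>
  Everything rests on Lagrange's identity
  \<open>(\<Sum>j. (a j)\<^sup>2) * (\<Sum>k. (b k)\<^sup>2) = (\<Sum>j. a j * b j)\<^sup>2 + (\<Sum>k. \<Sum>j<k. (a j * b k - a k * b j)\<^sup>2)\<close>,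
  which holds in every commutative ring (\<open>lagrange_identity\<close>).  Solving it for the square of
  \<open>\<Sum>j. a j * b j\<close> writes that square as a difference, and in an ultrametric the value of a finite
  sum or difference is bounded by the largest value of its terms (\<open>val_sum_le\<close>, \<open>val_diff_le_max\<close>).
  This turns the identity into the first inequality, multiplicativity of the valuation taking care
  of products and squares.

  For the second inequality, let \<open>P\<close> and \<open>Q\<close> be the largest values of the \<open>a j\<close> and the \<open>b k\<close>.
  The same bound gives at most \<open>P\<^sup>2\<close> and \<open>Q\<^sup>2\<close> for the two sums of squares, and at most \<open>P * Q\<close> for
  each \<open>a j * b k - a k * b j\<close>, since both of its terms have value at most \<open>P * Q\<close>.
\<close>

text \<open>Summing the pairs by their larger index makes induction on \<open>n\<close> work: the new index \<open>n + 1\<close>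
  contributes exactly one inner sum, which expands to three sums over \<open>{1..n}\<close>.\<close>

lemma lagrange_identity:
  fixes a b :: "nat \<Rightarrow> 'a::comm_ring_1"
  shows "(\<Sum>j=1..n. (a j)\<^sup>2) * (\<Sum>k=1..n. (b k)\<^sup>2)
           = (\<Sum>j=1..n. a j * b j)\<^sup>2 + (\<Sum>k=1..n. \<Sum>j=1..<k. (a j * b k - a k * b j)\<^sup>2)"
proof (induction n)
  case 0
  show ?case by simp
next
  case (Suc n)
  define A B C where "A = (\<Sum>j=1..n. (a j)\<^sup>2)" and "B = (\<Sum>j=1..n. (b j)\<^sup>2)"
    and "C = (\<Sum>j=1..n. a j * b j)"
  let ?x = "a (Suc n)" and ?y = "b (Suc n)"
  have "(\<Sum>j=1..<Suc n. (a j * ?y - ?x * b j)\<^sup>2)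
      = (\<Sum>j=1..n. ?y\<^sup>2 * (a j)\<^sup>2 - 2 * ?x * ?y * (a j * b j) + ?x\<^sup>2 * (b j)\<^sup>2)"
    by (rule sum.cong) (auto simp: power2_eq_square algebra_simps)
  also have "\<dots> = ?y\<^sup>2 * A - 2 * ?x * ?y * C + ?x\<^sup>2 * B"
    by (simp add: A_def B_def C_def sum.distrib sum_subtractf sum_distrib_left)
  finally have new_pairs: "(\<Sum>j=1..<Suc n. (a j * ?y - ?x * b j)\<^sup>2)
      = ?y\<^sup>2 * A - 2 * ?x * ?y * C + ?x\<^sup>2 * B" .
  have "(A + ?x\<^sup>2) * (B + ?y\<^sup>2) = A * B + ?y\<^sup>2 * A + ?x\<^sup>2 * B + ?x\<^sup>2 * ?y\<^sup>2"
    by (simp add: algebra_simps)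
  also have "\<dots> = (C + ?x * ?y)\<^sup>2 + ((\<Sum>k=1..n. \<Sum>j=1..<k. (a j * b k - a k * b j)\<^sup>2)
      + (?y\<^sup>2 * A - 2 * ?x * ?y * C + ?x\<^sup>2 * B))"
    using Suc.IH by (simp add: A_def B_def C_def power2_eq_square algebra_simps)
  finally show ?case
    using new_pairs by (simp add: A_def B_def C_def)
qed

context nonarch_valued_field
begin

lemma val_zero: "val 0 = 0"
  by (simp add: val_eq_0_iff)

text \<open>Taking values in \<open>(-x) * (-x) = x * x\<close> equates two squares of nonnegative reals.\<close>

lemma val_minus: "val (- x) = val x"
proof -
  have "(val (- x))\<^sup>2 = (val x)\<^sup>2"
    by (simp add: power2_eq_square flip: val_mult)
  then show ?thesis
    using val_nonneg by (simp add: power2_eq_iff_nonneg)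
qed

lemma val_power2: "val (x\<^sup>2) = (val x)\<^sup>2"
  by (simp add: power2_eq_square val_mult)

lemma val_diff_le_max: "val (x - y) \<le> max (val x) (val y)"
  using val_add_le_max[of x "- y"] by (simp add: val_minus)

text \<open>Nonnegativity of the bound \<open>M\<close> covers an empty or infinite \<open>I\<close>, for which
  the sum is \<open>0\<close>.\<close>

lemma val_sum_le:
  assumes "\<And>i. i \<in> I \<Longrightarrow> val (f i) \<le> M" and "0 \<le> M"
  shows "val (sum f I) \<le> M"
  using assms
proof (induction I rule: infinite_finite_induct)
  case (insert i I)
  have "val (f i + sum f I) \<le> max (val (f i)) (val (sum f I))"
    by (rule val_add_le_max)
  also have "\<dots> \<le> M"
    using insert by simp
  finally show ?case
    using insert.hyps by simp
qed (simp_all add: val_zero)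

end

lemma Max0_upper:
  assumes "finite A" and "x \<in> A"
  shows "x \<le> Max0 A"
  using assms by (auto simp: Max0_def)

lemma Max0_least:
  assumes "finite A" and "\<And>x. x \<in> A \<Longrightarrow> x \<le> M" and "0 \<le> M"
  shows "Max0 A \<le> M"
  using assms by (auto simp: Max0_def)

lemma Max0_nonneg:
  assumes "finite A" and "\<And>x. x \<in> A \<Longrightarrow> 0 \<le> x"
  shows "0 \<le> Max0 A"
  using assms by (auto simp: Max0_def)

theorem theorem2p1:
  fixes val :: "'a::field \<Rightarrow> real"
    and n :: nat
    and a b :: "nat \<Rightarrow> 'a"
  assumes "nonarch_valued_field val"
    and "n \<ge> 1"
  shows "(val (\<Sum>j=1..n. a j * b j))\<^sup>2
           \<le> max (val (\<Sum>j=1..n. (a j)\<^sup>2) * val (\<Sum>k=1..n. (b k)\<^sup>2))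
                 (Max0 {(val (a j * b k - a k * b j))\<^sup>2 | j k. 1 \<le> j \<and> j < k \<and> k \<le> n})
       \<and> max (val (\<Sum>j=1..n. (a j)\<^sup>2) * val (\<Sum>k=1..n. (b k)\<^sup>2))
                 (Max0 {(val (a j * b k - a k * b j))\<^sup>2 | j k. 1 \<le> j \<and> j < k \<and> k \<le> n})
           \<le> (Max {val (a j) | j. 1 \<le> j \<and> j \<le> n})\<^sup>2 * (Max {val (b k) | k. 1 \<le> k \<and> k \<le> n})\<^sup>2"
proof -
  interpret nonarch_valued_field val by fact
  define A B C where "A = (\<Sum>j=1..n. (a j)\<^sup>2)" and "B = (\<Sum>k=1..n. (b k)\<^sup>2)"
    and "C = (\<Sum>j=1..n. a j * b j)"
  define D where "D = (\<Sum>k=1..n. \<Sum>j=1..<k. (a j * b k - a k * b j)\<^sup>2)"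
  define S where "S = {(val (a j * b k - a k * b j))\<^sup>2 | j k. 1 \<le> j \<and> j < k \<and> k \<le> n}"
  define P Q where "P = Max {val (a j) | j. 1 \<le> j \<and> j \<le> n}"
    and "Q = Max {val (b k) | k. 1 \<le> k \<and> k \<le> n}"

  have "S \<subseteq> (\<lambda>(j, k). (val (a j * b k - a k * b j))\<^sup>2) ` ({1..n} \<times> {1..n})"
    by (force simp: S_def)
  then have fin_S: "finite S"
    by (rule finite_subset) simp
  have S_nonneg: "0 \<le> Max0 S"
    using fin_S by (rule Max0_nonneg) (auto simp: S_def)

  have a_le: "val (a j) \<le> P" and b_le: "val (b j) \<le> Q" if "1 \<le> j" "j \<le> n" for j
    using that by (auto simp: P_def Q_def intro!: Max_ge)
  have P_nonneg: "0 \<le> P" and Q_nonneg: "0 \<le> Q"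
    using a_le[of 1] b_le[of 1] val_nonneg[of "a 1"] val_nonneg[of "b 1"] \<open>n \<ge> 1\<close> by simp_all

  have "val D \<le> Max0 S"
    unfolding D_def
  proof (intro val_sum_le S_nonneg)
    fix k j assume "k \<in> {1..n}" "j \<in> {1..<k}"
    then have "(val (a j * b k - a k * b j))\<^sup>2 \<in> S"
      by (auto simp: S_def)
    then show "val ((a j * b k - a k * b j)\<^sup>2) \<le> Max0 S"
      using fin_S by (simp add: val_power2 Max0_upper)
  qed
  moreover have "C\<^sup>2 = A * B - D"
    using lagrange_identity[of a n b] by (simp add: A_def B_def C_def D_def)
  then have "(val C)\<^sup>2 \<le> max (val A * val B) (val D)"
    using val_diff_le_max[of "A * B" D] by (simp add: val_mult flip: val_power2)
  ultimately have lower: "(val C)\<^sup>2 \<le> max (val A * val B) (Max0 S)"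
    by linarith

  have "val A \<le> P\<^sup>2"
    unfolding A_def
    by (rule val_sum_le) (auto simp: val_power2 intro!: power_mono a_le val_nonneg)
  moreover have "val B \<le> Q\<^sup>2"
    unfolding B_def
    by (rule val_sum_le) (auto simp: val_power2 intro!: power_mono b_le val_nonneg)
  ultimately have upper_sums: "val A * val B \<le> P\<^sup>2 * Q\<^sup>2"
    by (intro mult_mono val_nonneg) simp_all

  have upper_pairs: "Max0 S \<le> P\<^sup>2 * Q\<^sup>2"
    using fin_S
  proof (rule Max0_least)
    fix x assume "x \<in> S"
    then obtain j k where x: "x = (val (a j * b k - a k * b j))\<^sup>2" and jk: "1 \<le> j" "j < k" "k \<le> n"
      by (auto simp: S_def)
    have "val (a j * b k) \<le> P * Q" "val (a k * b j) \<le> P * Q"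
      unfolding val_mult using jk
      by (auto intro!: mult_mono a_le b_le val_nonneg P_nonneg)
    then have "val (a j * b k - a k * b j) \<le> P * Q"
      using val_diff_le_max[of "a j * b k" "a k * b j"] by linarith
    then have "x \<le> (P * Q)\<^sup>2"
      unfolding x by (intro power_mono val_nonneg)
    then show "x \<le> P\<^sup>2 * Q\<^sup>2"
      by (simp add: power_mult_distrib)
  qed simp

  show ?thesis
    using lower upper_sums upper_pairs
    unfolding A_def B_def C_def S_def P_def Q_def by simp
qed

end
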